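(* Let $(M,d)$ be a metric space. Any one of the following properties implies that $M$ has the long trapezoid property (LTP): (1) $M$ is unbounded. (2) $\inf\{d(x,y): x,y\in M,\ x\neq y\}=0$. (3) $M$ is (isometric to) an infinite subset of an $\mathbb R$-tree, equipped with the restricted metric.
   Context: A metric space $(M,d)$ has the long trapezoid property (LTP) if for each finite subset $N\subseteq M$ and each $\varepsilon>0$ there exist $u,v\in M$, $u\neq v$, such that $(1-\varepsilon)(d(x,y)+d(u,v))\leq d(x,u)+d(y,v)$ holds for all $x,y\in N$. An $\mathbb R$-tree is a metric space $T$ in which any two points $x,y$ are joined by a unique geodesic segment $[x,y]$ (isometric image of an interval of length $d(x,y)$ with endpoints mapped to $x,y$), and such that if $[x,y]\cap[y,z]=\{y\}$ then $[x,y]\cup[y,z]=[x,z]$. *)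

theory Defs
  imports "HOL-Analysis.Analysis"
begin

definition long_trapezoid_property :: "'a set \<Rightarrow> ('a \<Rightarrow> 'a \<Rightarrow> real) \<Rightarrow> bool" where
  "long_trapezoid_property M d \<longleftrightarrow>
     (\<forall>N \<epsilon>. N \<subseteq> M \<longrightarrow> finite N \<longrightarrow> \<epsilon> > 0 \<longrightarrow>
        (\<exists>u\<in>M. \<exists>v\<in>M. u \<noteq> v \<and>
           (\<forall>x\<in>N. \<forall>y\<in>N. (1 - \<epsilon>) * (d x y + d u v) \<le> d x u + d y v)))"

(* The infimum is taken in the extended reals, so that it is \<infinity> when M has fewer than
   two points; for the type real the value of Inf {} is not meaningful. *)
definition separation :: "'a set \<Rightarrow> ('a \<Rightarrow> 'a \<Rightarrow> real) \<Rightarrow> ereal" where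
  "separation M d = Inf {ereal (d x y) | x y. x \<in> M \<and> y \<in> M \<and> x \<noteq> y}"

definition isometry_onto ::
  "'a set \<Rightarrow> ('a \<Rightarrow> 'a \<Rightarrow> real) \<Rightarrow> 'b set \<Rightarrow> ('b \<Rightarrow> 'b \<Rightarrow> real) \<Rightarrow> ('a \<Rightarrow> 'b) \<Rightarrow> bool" where
  "isometry_onto M d S e f \<longleftrightarrow>
     bij_betw f M S \<and> (\<forall>x\<in>M. \<forall>y\<in>M. e (f x) (f y) = d x y)"

(* A geodesic segment is a set of points, not a parametrization. *)
definition is_geodesic_segment ::
  "'b set \<Rightarrow> ('b \<Rightarrow> 'b \<Rightarrow> real) \<Rightarrow> 'b \<Rightarrow> 'b \<Rightarrow> 'b set \<Rightarrow> bool" where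
  "is_geodesic_segment T e x y S \<longleftrightarrow> S \<subseteq> T \<and>
     (\<exists>\<gamma>. isometry_onto {0..e x y} dist S e \<gamma> \<and> \<gamma> 0 = x \<and> \<gamma> (e x y) = y)"

definition geodesic_segment ::
  "'b set \<Rightarrow> ('b \<Rightarrow> 'b \<Rightarrow> real) \<Rightarrow> 'b \<Rightarrow> 'b \<Rightarrow> 'b set" where
  "geodesic_segment T e x y = (THE S. is_geodesic_segment T e x y S)"

definition real_tree :: "'b set \<Rightarrow> ('b \<Rightarrow> 'b \<Rightarrow> real) \<Rightarrow> bool" where
  "real_tree T e \<longleftrightarrow> Metric_space T e \<and>
     (\<forall>x\<in>T. \<forall>y\<in>T. \<exists>!S. is_geodesic_segment T e x y S) \<and>
     (\<forall>x\<in>T. \<forall>y\<in>T. \<forall>z\<in>T.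
        geodesic_segment T e x y \<inter> geodesic_segment T e y z = {y} \<longrightarrow>
        geodesic_segment T e x y \<union> geodesic_segment T e y z = geodesic_segment T e x z)"

end

theory Submission
  imports Defs
begin

text \<open>
  An unbounded space has LTP with \<open>u\<close> fixed and \<open>v\<close> far away, and a space with arbitrarily small
  distances has LTP with \<open>u\<close> and \<open>v\<close> very close together. An \<open>\<real>\<close>-tree satisfies the four-point
  inequality \<open>d x y + d u v \<le> max (d x u + d y v) (d x v + d y u)\<close>. If \<open>M\<close> is infinite and bounded,
  the pigeonhole principle yields \<open>u \<noteq> v\<close> whose distances to every point of the finite set \<open>N\<close>
  almost agree. The two sums in the maximum then almost agree as well, and the error is absorbed by
  \<open>\<epsilon> * d u v\<close>, as \<open>d u v\<close> is bounded below unless there are arbitrarily small distances.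
\<close>

section \<open>Unbounded spaces and spaces with small distances\<close>

text \<open>The left-hand side decreases as \<open>\<epsilon>\<close> grows, so a large
  \<open>\<epsilon>\<close> may be replaced by \<open>1/2\<close>. With
  \<open>\<epsilon> < 1\<close> the factor \<open>1 - \<epsilon>\<close> is positive and multiplying
  a distance by it does not increase it.\<close>

lemma (in Metric_space) long_trapezoid_propertyI:
  assumes "\<And>N \<epsilon>. \<lbrakk>N \<subseteq> M; finite N; 0 < \<epsilon>; \<epsilon> < 1\<rbrakk> \<Longrightarrow>
    \<exists>u\<in>M. \<exists>v\<in>M. u \<noteq> v \<and> (\<forall>x\<in>N. \<forall>y\<in>N. (1 - \<epsilon>) * (d x y + d u v) \<le> d x u + d y v)"
  shows "long_trapezoid_property M d"
  unfolding long_trapezoid_property_def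
proof (intro allI impI)
  fix N and \<epsilon> :: real
  assume N: "N \<subseteq> M" "finite N" and \<epsilon>: "\<epsilon> > 0"
  let ?\<delta> = "min \<epsilon> (1/2)"
  have \<delta>: "0 < ?\<delta>" "?\<delta> < 1" using \<epsilon> by auto
  obtain u v where uv: "u \<in> M" "v \<in> M" "u \<noteq> v"
    and le: "\<And>x y. \<lbrakk>x \<in> N; y \<in> N\<rbrakk> \<Longrightarrow> (1 - ?\<delta>) * (d x y + d u v) \<le> d x u + d y v"
    using assms[OF N \<delta>] by blast
  have "(1 - \<epsilon>) * (d x y + d u v) \<le> d x u + d y v" if "x \<in> N" "y \<in> N" for x y
  proof -
    have "(1 - \<epsilon>) * (d x y + d u v) \<le> (1 - ?\<delta>) * (d x y + d u v)"
      by (intro mult_right_mono) auto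
    with le[OF that] show ?thesis by linarith
  qed
  with uv show "\<exists>u\<in>M. \<exists>v\<in>M. u \<noteq> v \<and>
      (\<forall>x\<in>N. \<forall>y\<in>N. (1 - \<epsilon>) * (d x y + d u v) \<le> d x u + d y v)"
    by blast
qed

lemma (in Metric_space) long_trapezoid_property_if_unbounded:
  assumes unbounded: "\<not> mbounded M"
  shows "long_trapezoid_property M d"
proof (rule long_trapezoid_propertyI)
  fix N and \<epsilon> :: real
  assume N: "N \<subseteq> M" "finite N" and \<epsilon>: "0 < \<epsilon>" "\<epsilon> < 1"
  have "M \<noteq> {}"
    using unbounded mbounded_empty by metis
  then obtain u where u: "u \<in> M" by blast
  have "mbounded N"
    using N(2,1) by induction (auto simp: mbounded_insert)
  then have "mbounded (insert u N)"
    using u by (simp add: mbounded_insert)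
  then obtain R where R: "\<And>x y. \<lbrakk>x \<in> insert u N; y \<in> insert u N\<rbrakk> \<Longrightarrow> d x y \<le> R"
    unfolding mbounded_alt by blast
  have "R \<ge> 0"
    using R[of u u] by (meson insertI1 nonneg order_trans)
  \<comment> \<open>The radius makes the gain \<open>\<epsilon> * d u v\<close> at least
    \<open>2 * R\<close>. This pays for \<open>d x y\<close> on the left and for the detour
    \<open>d u y\<close> in \<open>d u v \<le> d u y + d y v\<close>, each at most
    \<open>R\<close>.\<close>
  have "\<not> M \<subseteq> mcball u (2 * R / \<epsilon>)"
    using unbounded unfolding mbounded_def by blast
  then have "\<exists>v\<in>M. d u v > 2 * R / \<epsilon>"
    using u by (auto simp: mcball_def not_le)
  then obtain v where v: "v \<in> M" and far: "d u v > 2 * R / \<epsilon>"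
    by blast
  have "d u v > 0"
    using far \<open>R \<ge> 0\<close> \<epsilon> by (smt (verit) divide_nonneg_pos)
  then have "u \<noteq> v" using u by auto
  moreover have "(1 - \<epsilon>) * (d x y + d u v) \<le> d x u + d y v" if "x \<in> N" "y \<in> N" for x y
  proof -
    have "2 * R \<le> \<epsilon> * d u v"
      using far \<epsilon> by (simp add: field_simps)
    moreover have "(1 - \<epsilon>) * d x y \<le> d x y"
      using \<epsilon> by (simp add: mult_left_le_one_le)
    moreover have "d u v \<le> d u y + d y v"
      using u v N that by (intro triangle) auto
    moreover have "0 \<le> d x u" "d x y \<le> R" "d u y \<le> R"
      using R that by auto
    ultimately show ?thesis
      unfolding distrib_left left_diff_distrib mult_1 by linarith
  qed
  ultimately show "\<exists>u\<in>M. \<exists>v\<in>M. u \<noteq> v \<and>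
      (\<forall>x\<in>N. \<forall>y\<in>N. (1 - \<epsilon>) * (d x y + d u v) \<le> d x u + d y v)"
    using u v by blast
qed

lemma (in Metric_space) finite_imp_separated:
  assumes "finite N" "N \<subseteq> M"
  obtains s where "s > 0" "\<And>x y. \<lbrakk>x \<in> N; y \<in> N; x \<noteq> y\<rbrakk> \<Longrightarrow> s \<le> d x y"
proof -
  let ?D = "(\<lambda>(x, y). d x y) ` {(x, y) \<in> N \<times> N. x \<noteq> y}"
  have "finite ?D"
    using assms(1) by (intro finite_imageI) (auto intro: finite_subset[of _ "N \<times> N"])
  moreover have "\<forall>r\<in>?D. r > 0"
    using assms(2) by (auto simp: subset_iff)
  \<comment> \<open>Inserting \<open>1\<close> keeps the minimum meaningful when \<open>N\<close>
    has at most one point and \<open>?D\<close> is empty.\<close>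
  ultimately have "Min (insert 1 ?D) > 0" "\<forall>r\<in>?D. Min (insert 1 ?D) \<le> r"
    by auto
  then show thesis
    by (intro that[of "Min (insert 1 ?D)"]) (auto simp: image_iff)
qed

lemma (in Metric_space) long_trapezoid_property_if_small_distances:
  assumes small: "\<And>r. r > 0 \<Longrightarrow> \<exists>x\<in>M. \<exists>y\<in>M. x \<noteq> y \<and> d x y < r"
  shows "long_trapezoid_property M d"
proof (rule long_trapezoid_propertyI)
  fix N and \<epsilon> :: real
  assume N: "N \<subseteq> M" "finite N" and \<epsilon>: "0 < \<epsilon>" "\<epsilon> < 1"
  obtain s where s: "s > 0" "\<And>x y. \<lbrakk>x \<in> N; y \<in> N; x \<noteq> y\<rbrakk> \<Longrightarrow> s \<le> d x y"
    using finite_imp_separated N by blast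
  \<comment> \<open>For \<open>x \<noteq> y\<close> the distance \<open>d u v\<close> is paid twice:
    once as a summand on the left, once on the way from \<open>x\<close> to \<open>y\<close> through
    \<open>u\<close> and \<open>v\<close>. The gain \<open>\<epsilon> * d x y\<close> is at least
    \<open>\<epsilon> * s\<close>, hence the half. For \<open>x = y\<close> the triangle inequality
    is enough.\<close>
  then obtain u v where uv: "u \<in> M" "v \<in> M" "u \<noteq> v" and close: "d u v < \<epsilon> * s / 2"
    using small[of "\<epsilon> * s / 2"] \<epsilon> by auto
  have "(1 - \<epsilon>) * (d x y + d u v) \<le> d x u + d y v" if xy: "x \<in> N" "y \<in> N" for x y
  proof -
    have M: "x \<in> M" "y \<in> M" using N xy by auto
    have *: "(1 - \<epsilon>) * d u v \<le> d u v"
      using \<epsilon> by (simp add: mult_left_le_one_le)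
    show ?thesis
    proof (cases "x = y")
      case True
      have "(1 - \<epsilon>) * d u v \<le> d x u + d x v"
        using * triangle[of u x v] M uv commute[of x u] by linarith
      then show ?thesis
        using True M by simp
    next
      case False
      have "\<epsilon> * s \<le> \<epsilon> * d x y"
        using s(2)[OF xy False] \<epsilon> by simp
      moreover have "d x y \<le> d x u + d u v + d y v"
        using triangle[of x u y] triangle[of u v y] M uv commute[of v y] by linarith
      ultimately show ?thesis
        using * close by (simp add: algebra_simps)
    qed
  qed
  with uv show "\<exists>u\<in>M. \<exists>v\<in>M. u \<noteq> v \<and>
      (\<forall>x\<in>N. \<forall>y\<in>N. (1 - \<epsilon>) * (d x y + d u v) \<le> d x u + d y v)"
    by blast
qed

section \<open>The four-point inequality\<close>

text \<open>Pigeonhole on cells of width \<open>\<eta>\<close>: each \<open>f i\<close> meets only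
  finitely many cells, so two points of \<open>A\<close> lie in the same cell for every
  \<open>i\<close> in the finite set \<open>I\<close>.\<close>

lemma infinite_imp_close_values:
  fixes f :: "'i \<Rightarrow> 'a \<Rightarrow> real"
  assumes "infinite A" "finite I" "\<eta> > 0"
    and bounded: "\<And>i a. \<lbrakk>i \<in> I; a \<in> A\<rbrakk> \<Longrightarrow> 0 \<le> f i a \<and> f i a \<le> R"
  obtains a b where "a \<in> A" "b \<in> A" "a \<noteq> b" "\<And>i. i \<in> I \<Longrightarrow> \<bar>f i a - f i b\<bar> < \<eta>"
proof -
  define g where "g a = (\<lambda>i\<in>I. \<lfloor>f i a / \<eta>\<rfloor>)" for a
  have "g ` A \<subseteq> (\<Pi>\<^sub>E i\<in>I. {0..\<lfloor>R / \<eta>\<rfloor>})"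
    using bounded \<open>\<eta> > 0\<close> by (auto simp: g_def intro!: floor_mono divide_right_mono)
  moreover have "finite (\<Pi>\<^sub>E i\<in>I. {0..\<lfloor>R / \<eta>\<rfloor>})"
    using \<open>finite I\<close> by (intro finite_PiE) auto
  ultimately have "finite (g ` A)"
    by (rule finite_subset)
  then have "\<not> inj_on g A"
    using \<open>infinite A\<close> finite_imageD by blast
  then obtain a b where ab: "a \<in> A" "b \<in> A" "a \<noteq> b" "g a = g b"
    by (auto simp: inj_on_def)
  have "\<bar>f i a - f i b\<bar> < \<eta>" if "i \<in> I" for i
  proof -
    have "\<lfloor>f i a / \<eta>\<rfloor> = \<lfloor>f i b / \<eta>\<rfloor>"
      using fun_cong[OF ab(4), of i] that by (simp add: g_def)
    then have "\<bar>f i a / \<eta> - f i b / \<eta>\<bar> < 1"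
      by linarith
    then show ?thesis
      using \<open>\<eta> > 0\<close> by (simp flip: diff_divide_distrib)
  qed
  with ab show thesis using that by blast
qed

lemma (in Metric_space) long_trapezoid_property_if_four_point:
  assumes "infinite M"
    and four_point: "\<And>x y u v. \<lbrakk>x \<in> M; y \<in> M; u \<in> M; v \<in> M\<rbrakk> \<Longrightarrow>
      d x y + d u v \<le> max (d x u + d y v) (d x v + d y u)"
  shows "long_trapezoid_property M d"
proof -
  let ?separated = "\<exists>s>0. \<forall>x\<in>M. \<forall>y\<in>M. x \<noteq> y \<longrightarrow> s \<le> d x y"
  \<comment> \<open>In the third case boundedness feeds the pigeonhole argument, and separation
    turns its additive error into a multiple of \<open>d u v\<close>.\<close>
  consider "\<not> mbounded M" | "\<not> ?separated" | "mbounded M" ?separated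
    by argo
  then show ?thesis
  proof cases
    case 1
    then show ?thesis by (rule long_trapezoid_property_if_unbounded)
  next
    case 2
    show ?thesis
    proof (rule long_trapezoid_property_if_small_distances, rule ccontr)
      fix r :: real
      assume "r > 0" "\<not> (\<exists>x\<in>M. \<exists>y\<in>M. x \<noteq> y \<and> d x y < r)"
      then have "r > 0 \<and> (\<forall>x\<in>M. \<forall>y\<in>M. x \<noteq> y \<longrightarrow> r \<le> d x y)"
        by (auto simp: not_less)
      then have ?separated ..
      with 2 show False by (rule notE)
    qed
  next
    case 3
    from 3(1) obtain R where R: "\<And>x y. \<lbrakk>x \<in> M; y \<in> M\<rbrakk> \<Longrightarrow> d x y \<le> R"
      unfolding mbounded_alt by blast
    from 3(2) obtain s where s: "s > 0" "\<And>x y. \<lbrakk>x \<in> M; y \<in> M; x \<noteq> y\<rbrakk> \<Longrightarrow> s \<le> d x y"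
      by (elim exE conjE) simp
    show ?thesis
    proof (rule long_trapezoid_propertyI)
      fix N and \<epsilon> :: real
      assume N: "N \<subseteq> M" "finite N" and \<epsilon>: "0 < \<epsilon>" "\<epsilon> < 1"
      \<comment> \<open>Exchanging \<open>u\<close> and \<open>v\<close> in
        \<open>d x v + d y u\<close> changes two distances, so this tolerance gives a total error
        below \<open>\<epsilon> * s\<close>, which is at most
        \<open>\<epsilon> * d u v\<close>.\<close>
      have "\<epsilon> * s / 2 > 0" using \<epsilon> s(1) by simp
      moreover have "\<And>x u. \<lbrakk>x \<in> N; u \<in> M\<rbrakk> \<Longrightarrow> 0 \<le> d x u \<and> d x u \<le> R"
        using R N by auto
      ultimately obtain u v where uv: "u \<in> M" "v \<in> M" "u \<noteq> v"
        and close: "\<And>x. x \<in> N \<Longrightarrow> \<bar>d x u - d x v\<bar> < \<epsilon> * s / 2"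
        using infinite_imp_close_values[OF \<open>infinite M\<close> \<open>finite N\<close>, of "\<epsilon> * s / 2" d R] by blast
      have "(1 - \<epsilon>) * (d x y + d u v) \<le> d x u + d y v" if "x \<in> N" "y \<in> N" for x y
      proof -
        have "d x y + d u v \<le> max (d x u + d y v) (d x v + d y u)"
          using four_point N that uv by blast
        then have "d x y + d u v \<le> d x u + d y v + \<epsilon> * s"
          using close[OF that(1)] close[OF that(2)] \<open>\<epsilon> * s / 2 > 0\<close> by linarith
        moreover have "\<epsilon> * s \<le> \<epsilon> * d u v" "0 \<le> \<epsilon> * d x y"
          using s(2) uv \<epsilon> by auto
        ultimately show ?thesis
          by (simp add: algebra_simps)
      qed
      with uv show "\<exists>u\<in>M. \<exists>v\<in>M. u \<noteq> v \<and>
          (\<forall>x\<in>N. \<forall>y\<in>N. (1 - \<epsilon>) * (d x y + d u v) \<le> d x u + d y v)"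
        by blast
    qed
  qed
qed

section \<open>Real trees\<close>

lemma real_tree_ex1_geodesic_segment:
  assumes "real_tree T e" "x \<in> T" "y \<in> T"
  shows "\<exists>!S. is_geodesic_segment T e x y S"
  by (rule assms(1)[unfolded real_tree_def, THEN conjunct2, THEN conjunct1, rule_format,
      OF assms(2,3)])

lemma real_tree_geodesic_segment:
  assumes "real_tree T e" "x \<in> T" "y \<in> T"
  shows "is_geodesic_segment T e x y (geodesic_segment T e x y)"
  unfolding geodesic_segment_def by (rule theI'[OF real_tree_ex1_geodesic_segment[OF assms]])

lemma real_tree_geodesic_segment_eq:
  assumes "real_tree T e" "x \<in> T" "y \<in> T" "is_geodesic_segment T e x y S"
  shows "geodesic_segment T e x y = S"
  unfolding geodesic_segment_def
  by (rule the1_equality[OF real_tree_ex1_geodesic_segment[OF assms(1-3)] assms(4)])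

lemma real_tree_parametrization:
  assumes "real_tree T e" "x \<in> T" "y \<in> T"
  obtains \<gamma> where "\<gamma> ` {0..e x y} = geodesic_segment T e x y" "\<gamma> ` {0..e x y} \<subseteq> T"
    "\<gamma> 0 = x" "\<gamma> (e x y) = y"
    "\<And>s t. \<lbrakk>s \<in> {0..e x y}; t \<in> {0..e x y}\<rbrakk> \<Longrightarrow> e (\<gamma> s) (\<gamma> t) = \<bar>s - t\<bar>"
proof -
  let ?S = "geodesic_segment T e x y"
  have "?S \<subseteq> T" and ex: "\<exists>\<gamma>. isometry_onto {0..e x y} dist ?S e \<gamma> \<and> \<gamma> 0 = x \<and> \<gamma> (e x y) = y"
    using real_tree_geodesic_segment[OF assms] unfolding is_geodesic_segment_def by simp_all
  from ex obtain \<gamma> where \<gamma>: "isometry_onto {0..e x y} dist ?S e \<gamma>" "\<gamma> 0 = x" "\<gamma> (e x y) = y"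
    by (elim exE conjE)
  have "\<gamma> ` {0..e x y} = ?S"
    using \<gamma>(1) by (simp add: isometry_onto_def bij_betw_def)
  moreover from this have "\<gamma> ` {0..e x y} \<subseteq> T"
    using \<open>?S \<subseteq> T\<close> by simp
  moreover have "e (\<gamma> s) (\<gamma> t) = \<bar>s - t\<bar>" if "s \<in> {0..e x y}" "t \<in> {0..e x y}" for s t
    using \<gamma>(1) that unfolding isometry_onto_def dist_real_def by blast
  ultimately show thesis
    using \<gamma>(2,3) by (intro that)
qed

text \<open>Used to recognize pieces of a geodesic as segments after reparametrization; uniqueness
  then identifies them with \<open>geodesic_segment\<close>. The isometry condition at
  \<open>0\<close> and \<open>l\<close> forces \<open>l\<close> to be the distance of the
  endpoints.\<close>

lemma is_geodesic_segment_image: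
  fixes l :: real
  assumes "Metric_space T e" "\<gamma> ` {0..l} \<subseteq> T" "0 \<le> l"
    and iso: "\<And>s t. \<lbrakk>s \<in> {0..l}; t \<in> {0..l}\<rbrakk> \<Longrightarrow> e (\<gamma> s) (\<gamma> t) = \<bar>s - t\<bar>"
  shows "is_geodesic_segment T e (\<gamma> 0) (\<gamma> l) (\<gamma> ` {0..l})"
proof -
  interpret Metric_space T e by fact
  have l: "e (\<gamma> 0) (\<gamma> l) = l"
    using iso[of 0 l] \<open>0 \<le> l\<close> by simp
  have "inj_on \<gamma> {0..l}"
  proof (rule inj_onI)
    fix s t assume st: "s \<in> {0..l}" "t \<in> {0..l}" "\<gamma> s = \<gamma> t"
    then have "\<gamma> t \<in> T" using assms(2) by blast
    then have "e (\<gamma> s) (\<gamma> t) = 0" using st by simp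
    then show "s = t" using iso[OF st(1,2)] by simp
  qed
  then have "isometry_onto {0..l} dist (\<gamma> ` {0..l}) e \<gamma>"
    unfolding isometry_onto_def bij_betw_def dist_real_def using iso by simp
  then show ?thesis
    unfolding is_geodesic_segment_def l using assms(2) by (intro conjI exI[of _ \<gamma>]) simp_all
qed

text \<open>A parametrization starting at \<open>x\<close> has the distance from \<open>x\<close> as
  its parameter, so all distances can be read off from parameters.\<close>

lemma real_tree_segment_dist:
  assumes tree: "real_tree T e" and "x \<in> T" "y \<in> T"
    and "p \<in> geodesic_segment T e x y" "q \<in> geodesic_segment T e x y"
  shows "p \<in> T" "e x p + e p y = e x y" "e p q = \<bar>e x p - e x q\<bar>"
proof -
  obtain \<gamma> where \<gamma>: "\<gamma> ` {0..e x y} = geodesic_segment T e x y" "\<gamma> ` {0..e x y} \<subseteq> T"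
    "\<gamma> 0 = x" "\<gamma> (e x y) = y"
    "\<And>s t. \<lbrakk>s \<in> {0..e x y}; t \<in> {0..e x y}\<rbrakk> \<Longrightarrow> e (\<gamma> s) (\<gamma> t) = \<bar>s - t\<bar>"
    using real_tree_parametrization[OF assms(1-3)] by blast
  from assms(4,5) obtain s t
    where s: "s \<in> {0..e x y}" "p = \<gamma> s" and t: "t \<in> {0..e x y}" "q = \<gamma> t"
    unfolding \<gamma>(1)[symmetric] by blast
  show "p \<in> T" using s \<gamma>(2) by blast
  have xp: "e x p = s" and xq: "e x q = t"
    using \<gamma>(5)[of 0 s] \<gamma>(5)[of 0 t] \<gamma>(3) s t by auto
  have "e p y = e x y - s"
    using \<gamma>(5)[of s "e x y"] \<gamma>(4) s by auto
  then show "e x p + e p y = e x y" using xp by simp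
  show "e p q = \<bar>e x p - e x q\<bar>"
    unfolding xp xq using \<gamma>(5)[OF s(1) t(1)] s(2) t(2) by simp
qed

text \<open>The branch point \<open>c\<close> is where the segments from \<open>x\<close> to \<open>y\<close> and from \<open>x\<close> to \<open>z\<close> separate:
  beyond it they have no common point, so together they form the segment from \<open>y\<close> to \<open>z\<close>.\<close>

lemma real_tree_branch_point:
  assumes tree: "real_tree T e" and T: "x \<in> T" "y \<in> T" "z \<in> T"
  obtains c where "c \<in> geodesic_segment T e x y" "c \<in> geodesic_segment T e x z"
    "e y c + e c z = e y z"
proof -
  interpret Metric_space T e using tree by (simp add: real_tree_def)
  define a b where "a = e x y" and "b = e x z"
  have ab: "0 \<le> a" "0 \<le> b" by (auto simp: a_def b_def)
  obtain \<gamma> where \<gamma>: "\<gamma> ` {0..a} = geodesic_segment T e x y" "\<gamma> ` {0..a} \<subseteq> T"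
    "\<gamma> 0 = x" "\<gamma> a = y"
    and \<gamma>_iso: "\<And>s t. \<lbrakk>s \<in> {0..a}; t \<in> {0..a}\<rbrakk> \<Longrightarrow> e (\<gamma> s) (\<gamma> t) = \<bar>s - t\<bar>"
    unfolding a_def using real_tree_parametrization[OF tree T(1,2)] by blast
  obtain \<delta> where \<delta>: "\<delta> ` {0..b} = geodesic_segment T e x z" "\<delta> ` {0..b} \<subseteq> T"
    "\<delta> 0 = x" "\<delta> b = z"
    and \<delta>_iso: "\<And>s t. \<lbrakk>s \<in> {0..b}; t \<in> {0..b}\<rbrakk> \<Longrightarrow> e (\<delta> s) (\<delta> t) = \<bar>s - t\<bar>"
    unfolding b_def using real_tree_parametrization[OF tree T(1,3)] by blast
  \<comment> \<open>Comparing the two geodesics at the same parameter loses nothing: the parameter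
    of a common point is its distance from \<open>x\<close> on both.\<close>
  define K where "K = {t \<in> {0..a} \<inter> {0..b}. \<gamma> t = \<delta> t}"
  define m where "m = Sup K"
  have "0 \<in> K" using ab \<gamma> \<delta> by (simp add: K_def)
  have bdd: "bdd_above K" unfolding K_def by (intro bdd_aboveI[of _ a]) auto
  have le_m: "t \<le> m" if "t \<in> K" for t
    unfolding m_def using that bdd by (rule cSup_upper)
  have "m \<le> a" "m \<le> b"
    unfolding m_def by (rule cSup_least; use \<open>0 \<in> K\<close> in \<open>auto simp: K_def\<close>)+
  then have m: "m \<in> {0..a}" "m \<in> {0..b}"
    using le_m[OF \<open>0 \<in> K\<close>] by auto
  \<comment> \<open>The supremum is attained: for \<open>t\<close> in \<open>K\<close> close to
    \<open>m\<close>, passing through \<open>\<gamma> t = \<delta> t\<close> bounds the distance of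
    \<open>\<gamma> m\<close> and \<open>\<delta> m\<close> by \<open>2 * (m - t)\<close>.\<close>
  have "\<gamma> m = \<delta> m"
  proof (rule ccontr)
    have inT: "\<gamma> m \<in> T" "\<delta> m \<in> T" using m \<gamma>(2) \<delta>(2) by auto
    assume "\<gamma> m \<noteq> \<delta> m"
    then have "e (\<gamma> m) (\<delta> m) > 0" using inT by simp
    then obtain t where t: "t \<in> K" "m - e (\<gamma> m) (\<delta> m) / 2 < t"
      using less_cSupE[of "m - e (\<gamma> m) (\<delta> m) / 2" K] \<open>0 \<in> K\<close> unfolding m_def by auto
    have "e (\<gamma> m) (\<gamma> t) = m - t" "e (\<gamma> t) (\<delta> m) = m - t"
      using t(1) m le_m[OF t(1)] \<gamma>_iso[of m t] \<delta>_iso[of t m] by (auto simp: K_def)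
    moreover have "\<gamma> t \<in> T" using t(1) \<gamma>(2) unfolding K_def by blast
    ultimately show False
      using triangle[of "\<gamma> m" "\<gamma> t" "\<delta> m"] inT t(2) by simp
  qed
  define c where "c = \<gamma> m"
  have c: "c \<in> T" "c = \<delta> m" unfolding c_def using \<open>\<gamma> m = \<delta> m\<close> m(1) \<gamma>(2) by blast+

  have image_yc: "(\<lambda>r. \<gamma> (a - r)) ` {0..a - m} = \<gamma> ` {m..a}"
    using image_image[of \<gamma> "(-) a" "{0..a - m}"] by simp
  \<comment> \<open>The tail of \<open>\<gamma>\<close> is traversed backwards, from
    \<open>y\<close> to \<open>c\<close>, so that \<open>c\<close> becomes the middle point in the
    union axiom of \<open>real_tree\<close>.\<close>
  have "is_geodesic_segment T e (\<gamma> (a - 0)) (\<gamma> (a - (a - m))) ((\<lambda>r. \<gamma> (a - r)) ` {0..a - m})"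
  proof (rule is_geodesic_segment_image[OF Metric_space_axioms])
    show "(\<lambda>r. \<gamma> (a - r)) ` {0..a - m} \<subseteq> T"
      unfolding image_yc using m \<gamma>(2) by (auto simp: subset_iff)
    show "e (\<gamma> (a - s)) (\<gamma> (a - t)) = \<bar>s - t\<bar>" if "s \<in> {0..a - m}" "t \<in> {0..a - m}" for s t
      using \<gamma>_iso[of "a - s" "a - t"] that m by auto
  qed (use m in auto)
  then have "is_geodesic_segment T e y c (\<gamma> ` {m..a})"
    unfolding image_yc by (simp add: \<gamma>(4) c_def)
  then have yc: "geodesic_segment T e y c = \<gamma> ` {m..a}"
    using real_tree_geodesic_segment_eq[OF tree] T c(1) by blast
  have image_cz: "(\<lambda>r. \<delta> (m + r)) ` {0..b - m} = \<delta> ` {m..b}"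
    using image_image[of \<delta> "(+) m" "{0..b - m}"] by (simp add: add.commute)
  have "is_geodesic_segment T e (\<delta> (m + 0)) (\<delta> (m + (b - m))) ((\<lambda>r. \<delta> (m + r)) ` {0..b - m})"
  proof (rule is_geodesic_segment_image[OF Metric_space_axioms])
    show "(\<lambda>r. \<delta> (m + r)) ` {0..b - m} \<subseteq> T"
      unfolding image_cz using m \<delta>(2) by (auto simp: subset_iff)
    show "e (\<delta> (m + s)) (\<delta> (m + t)) = \<bar>s - t\<bar>" if "s \<in> {0..b - m}" "t \<in> {0..b - m}" for s t
      using \<delta>_iso[of "m + s" "m + t"] that m by auto
  qed (use m in auto)
  then have "is_geodesic_segment T e c z (\<delta> ` {m..b})"
    unfolding image_cz by (simp add: \<delta>(4) c(2))
  then have cz: "geodesic_segment T e c z = \<delta> ` {m..b}"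
    using real_tree_geodesic_segment_eq[OF tree] T c(1) by blast

  have c_image: "c \<in> \<gamma> ` A" "c \<in> \<delta> ` A" if "m \<in> A" for A
    using imageI[OF that, of \<gamma>] imageI[OF that, of \<delta>]
    unfolding c_def[symmetric] c(2)[symmetric] .
  have "\<gamma> ` {m..a} \<inter> \<delta> ` {m..b} = {c}"
  proof (intro equalityI subsetI)
    fix p assume "p \<in> \<gamma> ` {m..a} \<inter> \<delta> ` {m..b}"
    then obtain s t where s: "s \<in> {m..a}" "p = \<gamma> s" and t: "t \<in> {m..b}" "p = \<delta> t"
      by blast
    have "e x p = s" "e x p = t"
      using \<gamma>_iso[of 0 s] \<delta>_iso[of 0 t] \<gamma>(3) \<delta>(3) m s t by auto
    then have "s \<in> K" using m s t by (auto simp: K_def)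
    then have "s = m" using le_m[of s] s by auto
    then show "p \<in> {c}" using s c_def by simp
  next
    fix p assume "p \<in> {c}"
    then show "p \<in> \<gamma> ` {m..a} \<inter> \<delta> ` {m..b}" using c_image m by simp
  qed
  then have "geodesic_segment T e y c \<union> geodesic_segment T e c z = geodesic_segment T e y z"
    unfolding yc cz
    by (rule tree[unfolded real_tree_def, THEN conjunct2, THEN conjunct2, rule_format,
        OF T(2) c(1) T(3), unfolded yc cz])
  moreover have "c \<in> geodesic_segment T e y c"
    unfolding yc using m by (intro c_image) simp
  ultimately have "c \<in> geodesic_segment T e y z" by blast
  then have "e y c + e c z = e y z"
    using real_tree_segment_dist(2)[OF tree T(2,3)] by blast
  moreover have "c \<in> geodesic_segment T e x y" "c \<in> geodesic_segment T e x z"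
    unfolding \<gamma>(1)[symmetric] \<delta>(1)[symmetric] using c_image(1)[OF m(1)] c_image(2)[OF m(2)] by simp_all
  ultimately show thesis using that by blast
qed

text \<open>Let \<open>p\<close> be the branch point of the segments from \<open>x\<close> to
  \<open>y\<close> and to \<open>v\<close>. If \<open>c\<close> comes no later than \<open>p\<close>
  on the way from \<open>x\<close> to \<open>y\<close>, then it lies between \<open>x\<close> and
  \<open>v\<close>; otherwise it lies between \<open>y\<close> and \<open>v\<close>.\<close>

lemma real_tree_between_cases:
  assumes tree: "real_tree T e" and T: "x \<in> T" "y \<in> T" "v \<in> T"
    and c: "c \<in> geodesic_segment T e x y"
  shows "e x c + e c v = e x v \<or> e y c + e c v = e y v"
proof -
  interpret Metric_space T e using tree by (simp add: real_tree_def)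
  obtain p where p: "p \<in> geodesic_segment T e x y" "p \<in> geodesic_segment T e x v"
    and ypv: "e y p + e p v = e y v"
    using real_tree_branch_point[OF tree T] by blast
  note cxy = real_tree_segment_dist[OF tree T(1,2) c p(1)]
  note pxy = real_tree_segment_dist(1,2)[OF tree T(1,2) p(1) p(1)]
  note pxv = real_tree_segment_dist(2)[OF tree T(1,3) p(2) p(2)]
  have tri: "e c v \<le> e c p + e p v" "e x v \<le> e x c + e c v" "e y v \<le> e y c + e c v"
    using triangle T cxy(1) pxy(1) by auto
  show ?thesis
  proof (cases "e x c \<le> e x p")
    case True
    then show ?thesis using tri pxv cxy(3) by linarith
  next
    case False
    then show ?thesis
      using tri ypv pxy(2) cxy(2,3) commute[of y p] commute[of y c] by linarith
  qed
qed

text \<open>The branch point \<open>c\<close> is a median of \<open>x\<close>, \<open>y\<close>,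
  \<open>u\<close>, lying between any two of them. Split \<open>e x y\<close> at \<open>c\<close>
  and bound \<open>e u v\<close> by the path through \<open>c\<close>; the four resulting terms
  regroup to \<open>e x v + e y u\<close> if \<open>c\<close> is between \<open>x\<close> and
  \<open>v\<close>, and to \<open>e x u + e y v\<close> if it is between \<open>y\<close> and
  \<open>v\<close>.\<close>

lemma real_tree_four_point:
  assumes tree: "real_tree T e" and T: "x \<in> T" "y \<in> T" "u \<in> T" "v \<in> T"
  shows "e x y + e u v \<le> max (e x u + e y v) (e x v + e y u)"
proof -
  interpret Metric_space T e using tree by (simp add: real_tree_def)
  obtain c where c: "c \<in> geodesic_segment T e x y" "c \<in> geodesic_segment T e x u"
    and ycu: "e y c + e c u = e y u"
    using real_tree_branch_point[OF tree T(1,2,3)] by blast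
  note cxy = real_tree_segment_dist(1,2)[OF tree T(1,2) c(1) c(1)]
  note cxu = real_tree_segment_dist(2)[OF tree T(1,3) c(2) c(2)]
  have "e u v \<le> e u c + e c v" using triangle T cxy(1) by blast
  then show ?thesis
    using real_tree_between_cases[OF tree T(1,2,4) c(1)] ycu cxy(2) cxu
      commute[of y c] commute[of u c] by linarith
qed

section \<open>Zero separation, and the three conditions combined\<close>

lemma separation_zero_imp_small_distances:
  assumes "separation M d = 0" "r > 0"
  shows "\<exists>x\<in>M. \<exists>y\<in>M. x \<noteq> y \<and> d x y < r"
proof -
  have "Inf {ereal (d x y) | x y. x \<in> M \<and> y \<in> M \<and> x \<noteq> y} < ereal r"
    using assms by (simp add: separation_def)
  then show ?thesis
    unfolding Inf_less_iff by force
qed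

theorem mainTheorem3:
  fixes M :: "'a set" and d :: "'a \<Rightarrow> 'a \<Rightarrow> real"
    and T :: "'b set" and e :: "'b \<Rightarrow> 'b \<Rightarrow> real"
  assumes "Metric_space M d"
  shows "(\<not> Metric_space.mbounded M d M \<longrightarrow> long_trapezoid_property M d) \<and>
         (separation M d = 0 \<longrightarrow> long_trapezoid_property M d) \<and>
         (real_tree T e \<and> (\<exists>S f. S \<subseteq> T \<and> infinite S \<and> isometry_onto M d S e f)
            \<longrightarrow> long_trapezoid_property M d)"
proof (intro conjI impI)
  interpret Metric_space M d by fact
  show "long_trapezoid_property M d" if "\<not> mbounded M"
    using that by (rule long_trapezoid_property_if_unbounded)
  show "long_trapezoid_property M d" if "separation M d = 0"
    using long_trapezoid_property_if_small_distances separation_zero_imp_small_distances[OF that]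
    by blast
  show "long_trapezoid_property M d"
    if "real_tree T e \<and> (\<exists>S f. S \<subseteq> T \<and> infinite S \<and> isometry_onto M d S e f)"
  proof -
    from that obtain S f where tree: "real_tree T e" and S: "S \<subseteq> T" "infinite S"
      and bij: "bij_betw f M S" and iso: "\<And>x y. \<lbrakk>x \<in> M; y \<in> M\<rbrakk> \<Longrightarrow> e (f x) (f y) = d x y"
      unfolding isometry_onto_def by blast
    show ?thesis
    \<comment> \<open>The four-point inequality involves only distances between the four points, so
      it passes to subsets of the tree and back along \<open>f\<close>, although \<open>M\<close>
      itself need not be a tree.\<close>
    proof (rule long_trapezoid_property_if_four_point)
      show "infinite M" using bij_betw_finite[OF bij] S(2) by blast
      fix x y u v assume M: "x \<in> M" "y \<in> M" "u \<in> M" "v \<in> M"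
      then have "f x \<in> T" "f y \<in> T" "f u \<in> T" "f v \<in> T"
        using bij_betw_apply[OF bij] S(1) by auto
      from real_tree_four_point[OF tree this] M
      show "d x y + d u v \<le> max (d x u + d y v) (d x v + d y u)"
        by (simp add: iso)
    qed
  qed
qed

end
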